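(* Let $\Gamma$ be a finitely generated polycyclic group. Then $\operatorname{asdim}\Gamma\le h(\Gamma)$, where $h(\Gamma)$ is the Hirsch length of $\Gamma$.
   Context: For a metric space $X$, $\operatorname{asdim} X\le n$ means: for every $D>0$ there exist families $\mathcal{U}_0,\ldots,\mathcal{U}_n$ of uniformly bounded subsets of $X$, each $D$-disjoint (distinct members are at distance $>D$), whose union covers $X$. $\operatorname{asdim}X$ is the smallest such $n$. A finitely generated group carries the word metric of a finite generating set ($\operatorname{asdim}$ does not depend on the choice). A group $G$ is polycyclic if there is a sequence of subgroups $\{1\}=G_0\subset G_1\subset\cdots\subset G_n=G$ such that each $G_i$ is normal in $G_{i+1}$ and $G_{i+1}/G_i$ is cyclic. The Hirsch length $h(G)$ is the number of factors $G_{i+1}/G_i$ isomorphic to $\mathbb{Z}$. *)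

theory Defs
  imports "HOL-Analysis.Analysis" "HOL-Library.Extended_Nat" "HOL-Algebra.Elementary_Groups"
begin

section \<open>Asymptotic dimension\<close>

text \<open>The infimum is taken in the extended reals, so the distance to the empty set is infinite.\<close>

definition set_distance :: "('a \<Rightarrow> 'a \<Rightarrow> real) \<Rightarrow> 'a set \<Rightarrow> 'a set \<Rightarrow> ereal"
  where "set_distance d A B = (INF (x, y)\<in>A \<times> B. ereal (d x y))"

definition disjoint_family_at :: "('a \<Rightarrow> 'a \<Rightarrow> real) \<Rightarrow> real \<Rightarrow> 'a set set \<Rightarrow> bool"
  where "disjoint_family_at d D \<U> \<longleftrightarrow> (\<forall>A\<in>\<U>. \<forall>B\<in>\<U>. A \<noteq> B \<longrightarrow> ereal D < set_distance d A B)"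

definition uniformly_bounded_family :: "('a \<Rightarrow> 'a \<Rightarrow> real) \<Rightarrow> 'a set set \<Rightarrow> bool"
  where "uniformly_bounded_family d \<U> \<longleftrightarrow> (\<exists>R. \<forall>A\<in>\<U>. \<forall>x\<in>A. \<forall>y\<in>A. d x y \<le> R)"

definition asdim_at_most :: "'a set \<Rightarrow> ('a \<Rightarrow> 'a \<Rightarrow> real) \<Rightarrow> nat \<Rightarrow> bool"
  where "asdim_at_most M d n \<longleftrightarrow>
    (\<forall>D>0. \<exists>\<U> :: nat \<Rightarrow> 'a set set.
      (\<forall>i\<le>n. \<Union>(\<U> i) \<subseteq> M \<and> uniformly_bounded_family d (\<U> i) \<and> disjoint_family_at d D (\<U> i)) \<and>
      M \<subseteq> (\<Union>i\<le>n. \<Union>(\<U> i)))"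

text \<open>The infimum of the empty set of extended naturals is \<open>\<infinity>\<close>.\<close>

definition asdim :: "'a set \<Rightarrow> ('a \<Rightarrow> 'a \<Rightarrow> real) \<Rightarrow> enat"
  where "asdim M d = (INF n\<in>{n. asdim_at_most M d n}. enat n)"

lemma asdim_at_most_mono:
  assumes "asdim_at_most M d m" "m \<le> n"
  shows "asdim_at_most M d n"
  unfolding asdim_at_most_def
proof (intro allI impI)
  fix D :: real assume "0 < D"
  with assms(1) obtain \<U> :: "nat \<Rightarrow> 'a set set" where \<U>:
    "\<forall>i\<le>m. \<Union>(\<U> i) \<subseteq> M \<and> uniformly_bounded_family d (\<U> i) \<and> disjoint_family_at d D (\<U> i)"
    "M \<subseteq> (\<Union>i\<le>m. \<Union>(\<U> i))"
    unfolding asdim_at_most_def by meson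
  let ?\<V> = "\<lambda>i. if i \<le> m then \<U> i else {}"
  have "M \<subseteq> (\<Union>i\<le>n. \<Union>(?\<V> i))"
  proof
    fix x assume "x \<in> M"
    with \<U>(2) obtain i where "i \<le> m" "x \<in> \<Union>(\<U> i)" by blast
    then show "x \<in> (\<Union>i\<le>n. \<Union>(?\<V> i))" using assms(2) by (intro UN_I[of i]) auto
  qed
  then show "\<exists>\<V> :: nat \<Rightarrow> 'a set set.
      (\<forall>i\<le>n. \<Union>(\<V> i) \<subseteq> M \<and> uniformly_bounded_family d (\<V> i) \<and> disjoint_family_at d D (\<V> i)) \<and>
      M \<subseteq> (\<Union>i\<le>n. \<Union>(\<V> i))"
    using \<U>(1)
    by (intro exI[of _ ?\<V>]) (simp add: uniformly_bounded_family_def disjoint_family_at_def)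
qed

lemma asdim_le_enat_iff: "asdim M d \<le> enat n \<longleftrightarrow> asdim_at_most M d n"
proof
  assume "asdim_at_most M d n"
  then show "asdim M d \<le> enat n" unfolding asdim_def by (intro INF_lower) simp
next
  assume "asdim M d \<le> enat n"
  then have "asdim M d < enat (Suc n)" by (metis enat_ord_simps(2) le_less_trans lessI)
  then obtain m where "asdim_at_most M d m" "enat m < enat (Suc n)"
    unfolding asdim_def INF_less_iff by blast
  then show "asdim_at_most M d n" by (auto intro: asdim_at_most_mono)
qed


section \<open>Word metrics\<close>

definition word_length :: "('a, 'b) monoid_scheme \<Rightarrow> 'a set \<Rightarrow> 'a \<Rightarrow> nat"
  where "word_length G S x =
    (LEAST n. \<exists>ws. length ws = n \<and> set ws \<subseteq> S \<union> m_inv G ` S \<and> foldr (mult G) ws (one G) = x)"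

text \<open>
  The library's metric space locale requires nonnegativity and symmetry on the whole type, hence
  the default value outside the carrier.
\<close>

definition word_dist :: "('a, 'b) monoid_scheme \<Rightarrow> 'a set \<Rightarrow> 'a \<Rightarrow> 'a \<Rightarrow> real"
  where "word_dist G S x y =
    (if x \<in> carrier G \<and> y \<in> carrier G
     then real (word_length G S (inv\<^bsub>G\<^esub> x \<otimes>\<^bsub>G\<^esub> y)) else 0)"

context group
begin

definition is_word :: "'a set \<Rightarrow> 'a list \<Rightarrow> 'a \<Rightarrow> bool"
  where "is_word S ws x \<longleftrightarrow> set ws \<subseteq> S \<union> m_inv G ` S \<and> foldr (mult G) ws \<one> = x"

lemma foldr_closed: "set ws \<subseteq> carrier G \<Longrightarrow> foldr (mult G) ws \<one> \<in> carrier G"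
  by (induction ws) auto

lemma foldr_append_mult:
  "set us \<subseteq> carrier G \<Longrightarrow> set vs \<subseteq> carrier G \<Longrightarrow>
    foldr (mult G) (us @ vs) \<one> = foldr (mult G) us \<one> \<otimes> foldr (mult G) vs \<one>"
  by (induction us) (simp_all add: foldr_closed m_assoc)

lemma letters_closed: "S \<subseteq> carrier G \<Longrightarrow> S \<union> m_inv G ` S \<subseteq> carrier G"
  by auto

lemma is_word_append:
  assumes "S \<subseteq> carrier G" "is_word S us x" "is_word S vs y"
  shows "is_word S (us @ vs) (x \<otimes> y)"
proof -
  have "set us \<subseteq> carrier G" "set vs \<subseteq> carrier G"
    using assms letters_closed unfolding is_word_def by blast+
  from foldr_append_mult[OF this] have "foldr (mult G) (us @ vs) \<one> = x \<otimes> y"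
    using assms(2,3) unfolding is_word_def by (simp only:)
  then show ?thesis using assms unfolding is_word_def by simp
qed

lemma is_word_inv:
  assumes S: "S \<subseteq> carrier G" and "is_word S ws x"
  shows "is_word S (rev (map (m_inv G) ws)) (inv x)"
  using assms(2)
proof (induction ws arbitrary: x)
  case Nil
  then have "x = \<one>" by (simp add: is_word_def)
  then show ?case by (simp add: is_word_def)
next
  case (Cons a ws)
  define y where "y = foldr (mult G) ws \<one>"
  have a: "a \<in> S \<union> m_inv G ` S" "is_word S ws y" and x: "x = a \<otimes> y"
    using Cons.prems by (auto simp: is_word_def y_def)
  have cl: "a \<in> carrier G" using a S by auto
  have ycl: "y \<in> carrier G"
    unfolding y_def using a(2) letters_closed[OF S]
    by (intro foldr_closed) (auto simp: is_word_def)
  have "inv a \<in> S \<union> m_inv G ` S" using a(1) S by auto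
  then have "is_word S [inv a] (inv a)" using cl by (auto simp: is_word_def)
  then have "is_word S (rev (map (m_inv G) ws) @ [inv a]) (inv y \<otimes> inv a)"
    using is_word_append[OF S Cons.IH[OF a(2)]] by blast
  then show ?case using x cl ycl by (simp add: inv_mult_group)
qed

lemma word_length_eq: "word_length G S x = (LEAST n. \<exists>ws. length ws = n \<and> is_word S ws x)"
  by (simp add: word_length_def is_word_def)

lemma word_length_le: "is_word S ws x \<Longrightarrow> word_length G S x \<le> length ws"
  unfolding word_length_eq by (intro Least_le) blast

lemma generate_imp_word:
  assumes S: "S \<subseteq> carrier G" and "x \<in> generate G S"
  shows "\<exists>ws. is_word S ws x"
  using assms(2)
proof induction
  case one
  have "is_word S [] \<one>" by (simp add: is_word_def)
  then show ?case ..
next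
  case (incl h)
  then have "is_word S [h] h" using S by (auto simp: is_word_def)
  then show ?case ..
next
  case (inv h)
  then have "is_word S [inv h] (inv h)" using S by (auto simp: is_word_def)
  then show ?case ..
next
  case (eng h1 h2)
  then show ?case using is_word_append[OF S] by blast
qed

lemma word_length_attained:
  assumes "S \<subseteq> carrier G" "generate G S = carrier G" "x \<in> carrier G"
  obtains ws where "is_word S ws x" "length ws = word_length G S x"
proof -
  have "\<exists>n ws. length ws = n \<and> is_word S ws x"
    using generate_imp_word assms by blast
  from LeastI_ex[OF this] show ?thesis using that unfolding word_length_eq by blast
qed

lemma word_length_inv_le:
  assumes "S \<subseteq> carrier G" "generate G S = carrier G" "x \<in> carrier G"
  shows "word_length G S (inv x) \<le> word_length G S x"
proof -
  obtain ws where ws: "is_word S ws x" "length ws = word_length G S x"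
    by (rule word_length_attained[OF assms])
  show ?thesis using word_length_le[OF is_word_inv[OF assms(1) ws(1)]] ws(2) by simp
qed

lemma word_length_mult_le:
  assumes "S \<subseteq> carrier G" "generate G S = carrier G" "x \<in> carrier G" "y \<in> carrier G"
  shows "word_length G S (x \<otimes> y) \<le> word_length G S x + word_length G S y"
proof -
  obtain us where us: "is_word S us x" "length us = word_length G S x"
    by (rule word_length_attained[OF assms(1-3)])
  obtain vs where vs: "is_word S vs y" "length vs = word_length G S y"
    by (rule word_length_attained[OF assms(1,2,4)])
  show ?thesis
    using word_length_le[OF is_word_append[OF assms(1) us(1) vs(1)]] us(2) vs(2) by simp
qed

lemma word_length_eq_0_iff:
  assumes "S \<subseteq> carrier G" "generate G S = carrier G" "x \<in> carrier G"
  shows "word_length G S x = 0 \<longleftrightarrow> x = \<one>"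
proof
  assume 0: "word_length G S x = 0"
  obtain ws where "is_word S ws x" "length ws = word_length G S x"
    by (rule word_length_attained[OF assms])
  with 0 show "x = \<one>" by (simp add: is_word_def)
next
  assume "x = \<one>"
  then have "is_word S [] x" by (simp add: is_word_def)
  then show "word_length G S x = 0" using word_length_le[of S "[]" x] by simp
qed

lemma Metric_space_word_dist:
  assumes S: "S \<subseteq> carrier G" "generate G S = carrier G"
  shows "Metric_space (carrier G) (word_dist G S)"
proof
  fix x y z
  show "0 \<le> word_dist G S x y" by (simp add: word_dist_def)
  have le: "word_dist G S x y \<le> word_dist G S y x" for x y
  proof (cases "x \<in> carrier G \<and> y \<in> carrier G")
    case True
    then have "inv x \<otimes> y = inv (inv y \<otimes> x)" by (simp add: inv_mult_group)
    then show ?thesis using True word_length_inv_le[OF S, of "inv y \<otimes> x"]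
      by (simp add: word_dist_def)
  qed (auto simp: word_dist_def)
  show "word_dist G S x y = word_dist G S y x" using le by (intro antisym)
  assume xy: "x \<in> carrier G" "y \<in> carrier G"
  have "inv x \<otimes> y = \<one> \<longleftrightarrow> x = y"
    using xy inv_solve_left'[of "\<one>" x y] by auto
  then show "word_dist G S x y = 0 \<longleftrightarrow> x = y"
    using xy word_length_eq_0_iff[OF S, of "inv x \<otimes> y"] by (simp add: word_dist_def)
  assume z: "z \<in> carrier G"
  have "inv x \<otimes> z = (inv x \<otimes> y) \<otimes> (inv y \<otimes> z)"
    using xy z m_assoc[of y "inv y" z] by (simp add: m_assoc)
  then show "word_dist G S x z \<le> word_dist G S x y + word_dist G S y z"
    using xy z word_length_mult_le[OF S, of "inv x \<otimes> y" "inv y \<otimes> z"]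
    by (simp add: word_dist_def flip: of_nat_add)
qed

end


section \<open>Polycyclic groups and Hirsch length\<close>

definition factor_group :: "('a, 'b) monoid_scheme \<Rightarrow> (nat \<Rightarrow> 'a set) \<Rightarrow> nat \<Rightarrow> 'a set monoid"
  where "factor_group G H i = (G\<lparr>carrier := H (Suc i)\<rparr>) Mod (H i)"

definition polycyclic_series ::
    "('a, 'b) monoid_scheme \<Rightarrow> nat \<Rightarrow> (nat \<Rightarrow> 'a set) \<Rightarrow> bool"
  where "polycyclic_series G n H \<longleftrightarrow>
    H 0 = {\<one>\<^bsub>G\<^esub>} \<and> H n = carrier G \<and>
    (\<forall>i\<le>n. subgroup (H i) G) \<and>
    (\<forall>i<n. H i \<lhd> G\<lparr>carrier := H (Suc i)\<rparr> \<and> cyclic_group (factor_group G H i))"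

definition polycyclic :: "('a, 'b) monoid_scheme \<Rightarrow> bool"
  where "polycyclic G \<longleftrightarrow> (\<exists>n H. polycyclic_series G n H)"

definition infinite_cyclic_factors :: "('a, 'b) monoid_scheme \<Rightarrow> nat \<Rightarrow> (nat \<Rightarrow> 'a set) \<Rightarrow> nat"
  where "infinite_cyclic_factors G n H = card {i. i < n \<and> factor_group G H i \<cong> integer_group}"

text \<open>
  All polycyclic series of a group have the same number of infinite cyclic factors. Taking the
  least such number makes the definition independent of this fact, and a bound from above by
  the Hirsch length is then a bound by the number of infinite cyclic factors of every series.
\<close>

definition hirsch_length :: "('a, 'b) monoid_scheme \<Rightarrow> nat"
  where "hirsch_length G =
    (LEAST k. \<exists>n H. polycyclic_series G n H \<and> infinite_cyclic_factors G n H = k)"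

end

theory Submission
  imports Defs
begin

text \<open>
  Every term \<open>H i\<close> of a polycyclic series carries the restriction of the word metric of \<open>G\<close>, which
  is left invariant and has finite balls. A finite factor does not increase the asymptotic dimension,
  as \<open>H (Suc i)\<close> then lies within bounded distance of \<open>H i\<close>. For an infinite cyclic factor,
  the quotient map \<open>f\<close> to \<open>\<int>\<close> is coarsely Lipschitz, and left translations show that all preimages of
  intervals of a given length admit colourings by \<open>n + 1\<close> colours with the same bounds. Such a map
  increases the asymptotic dimension by at most one: the colourings of neighbouring slabs are merged
  by saturated unions, and Kolmogorov's trick supplies one more colour, so that one colour can be
  spared at every point to cut the chains along the \<open>\<int>\<close> direction.
\<close>

section \<open>Chains and bounded colourings\<close>

definition step_rel :: "('a \<Rightarrow> 'a \<Rightarrow> real) \<Rightarrow> real \<Rightarrow> 'a set \<Rightarrow> ('a \<times> 'a) set"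
  where "step_rel d r A = {(x, y). x \<in> A \<and> y \<in> A \<and> d x y \<le> r}"

text \<open>The \<open>r\<close>-chain components of \<open>A\<close> take the place of the members
  of a disjoint family, so that one set stands for a whole colour. \<open>B\<close> is a parameter
  because bounds uniform over infinitely many slabs are required later.\<close>

definition chain_bounded :: "('a \<Rightarrow> 'a \<Rightarrow> real) \<Rightarrow> real \<Rightarrow> real \<Rightarrow> 'a set \<Rightarrow> bool"
  where "chain_bounded d r B A \<longleftrightarrow>
    (\<forall>x\<in>A. \<forall>y\<in>A. (x, y) \<in> (step_rel d r A)\<^sup>* \<longrightarrow> d x y \<le> B)"

definition chain_cover :: "('a \<Rightarrow> 'a \<Rightarrow> real) \<Rightarrow> real \<Rightarrow> real \<Rightarrow> nat \<Rightarrow> 'a set \<Rightarrow> bool"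
  where "chain_cover d r B n A \<longleftrightarrow>
    (\<exists>X :: nat \<Rightarrow> 'a set. A \<subseteq> (\<Union>i\<le>n. X i) \<and> (\<forall>i\<le>n. X i \<subseteq> A \<and> chain_bounded d r B (X i)))"

lemma step_rel_mono: "A \<subseteq> A' \<Longrightarrow> r \<le> r' \<Longrightarrow> step_rel d r A \<subseteq> step_rel d r' A'"
  by (auto simp: step_rel_def)

lemma step_rel_rtrancl_mem: "(x, y) \<in> (step_rel d r A)\<^sup>* \<Longrightarrow> x \<in> A \<Longrightarrow> y \<in> A"
  by (induction rule: rtrancl_induct) (auto simp: step_rel_def)

lemma chain_bounded_mono:
  assumes "chain_bounded d r B A" "A' \<subseteq> A" "r' \<le> r" "B \<le> B'"
  shows "chain_bounded d r' B' A'"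
  using assms rtrancl_mono[OF step_rel_mono[OF assms(2,3)], of d]
  unfolding chain_bounded_def by (meson in_mono order_trans)

lemma chain_cover_mono:
  assumes "chain_cover d r B n A" "r' \<le> r" "B \<le> B'"
  shows "chain_cover d r' B' n A"
  using assms chain_bounded_mono[OF _ order_refl assms(2,3)] unfolding chain_cover_def by meson

text \<open>An additive error of \<open>T\<close> turns \<open>r\<close>-chains into
  \<open>(r + T)\<close>-chains under \<open>p\<close> and costs another \<open>T\<close> when the
  bound on \<open>d (p x) (p y)\<close> is carried back to \<open>x\<close> and
  \<open>y\<close>.\<close>

lemma chain_bounded_pullback:
  assumes A': "chain_bounded d (r + T) B A'" and p: "\<And>x. x \<in> A \<Longrightarrow> p x \<in> A'"
    and le: "\<And>x y. x \<in> A \<Longrightarrow> y \<in> A \<Longrightarrow> d (p x) (p y) \<le> d x y + T"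
    and ge: "\<And>x y. x \<in> A \<Longrightarrow> y \<in> A \<Longrightarrow> d x y \<le> d (p x) (p y) + T"
  shows "chain_bounded d r (B + T) A"
  unfolding chain_bounded_def
proof (intro ballI impI)
  fix x y assume xy: "x \<in> A" "y \<in> A" "(x, y) \<in> (step_rel d r A)\<^sup>*"
  have step: "(p u, p v) \<in> step_rel d (r + T) A'" if "(u, v) \<in> step_rel d r A" for u v
    using that p le[of u v] by (auto simp: step_rel_def)
  from xy(3) have "(p x, p y) \<in> (step_rel d (r + T) A')\<^sup>*"
    by induction (blast intro: step rtrancl_into_rtrancl)+
  then have "d (p x) (p y) \<le> B"
    using A' p xy unfolding chain_bounded_def by blast
  then show "d x y \<le> B + T" using ge[OF xy(1,2)] by simp
qed

lemma chain_cover_pullback: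
  assumes A': "chain_cover d (r + T) B n A'" and p: "\<And>x. x \<in> A \<Longrightarrow> p x \<in> A'"
    and "\<And>x y. x \<in> A \<Longrightarrow> y \<in> A \<Longrightarrow> d (p x) (p y) \<le> d x y + T"
    and "\<And>x y. x \<in> A \<Longrightarrow> y \<in> A \<Longrightarrow> d x y \<le> d (p x) (p y) + T"
  shows "chain_cover d r (B + T) n A"
proof -
  obtain X :: "nat \<Rightarrow> 'a set" where X: "A' \<subseteq> (\<Union>i\<le>n. X i)" "\<forall>i\<le>n. chain_bounded d (r + T) B (X i)"
    using A' unfolding chain_cover_def by blast
  have "A \<subseteq> (\<Union>i\<le>n. {x \<in> A. p x \<in> X i})" using X(1) p by blast
  moreover have "chain_bounded d r (B + T) {x \<in> A. p x \<in> X i}" if "i \<le> n" for i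
    using X(2) that by (intro chain_bounded_pullback[where A' = "X i" and p = p])
      (auto intro: assms(3,4))
  ultimately show ?thesis
    unfolding chain_cover_def by (intro exI[of _ "\<lambda>i. {x \<in> A. p x \<in> X i}"]) auto
qed

section \<open>Asymptotic dimension in terms of chain covers\<close>

context Metric_space
begin

lemma sym_step_rel: "sym (step_rel d r A)"
  by (auto simp: sym_def step_rel_def commute)

text \<open>A step of length at most \<open>D\<close> cannot leave a member of a
  \<open>D\<close>-disjoint family, so each chain stays in one member. The finitely many colours
  have a common diameter bound.\<close>

lemma asdim_at_most_imp_chain_cover:
  assumes "asdim_at_most M d n"
  shows "\<exists>B. chain_cover d r B n M"
proof -
  \<comment> \<open>The scale \<open>r\<close> is an arbitrary real here, whereas the definition of
    asymptotic dimension provides families for positive scales.\<close>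
  define D where "D = max r 1"
  have "D > 0" by (simp add: D_def)
  then obtain \<U> :: "nat \<Rightarrow> 'a set set" where \<U>:
    "\<forall>i\<le>n. \<Union>(\<U> i) \<subseteq> M \<and> uniformly_bounded_family d (\<U> i) \<and> disjoint_family_at d D (\<U> i)"
    "M \<subseteq> (\<Union>i\<le>n. \<Union>(\<U> i))"
    using assms unfolding asdim_at_most_def by meson
  have "\<forall>i. \<exists>R. i \<le> n \<longrightarrow> (\<forall>A\<in>\<U> i. \<forall>x\<in>A. \<forall>y\<in>A. d x y \<le> R)"
    using \<U>(1) unfolding uniformly_bounded_family_def by blast
  then obtain R where R: "\<And>i A x y. i \<le> n \<Longrightarrow> A \<in> \<U> i \<Longrightarrow> x \<in> A \<Longrightarrow> y \<in> A \<Longrightarrow> d x y \<le> R i"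
    by metis
  define B where "B = Max (R ` {..n})"
  have "chain_bounded d r B (\<Union>(\<U> i))" if i: "i \<le> n" for i
    unfolding chain_bounded_def
  proof (intro ballI impI)
    fix x y assume "x \<in> \<Union>(\<U> i)" "(x, y) \<in> (step_rel d r (\<Union>(\<U> i)))\<^sup>*"
    then obtain A where A: "A \<in> \<U> i" "x \<in> A" by blast
    from \<open>(x, y) \<in> _\<close> have "y \<in> A"
    proof (induction rule: rtrancl_induct)
      case base
      show ?case by (rule A(2))
    next
      case (step y z)
      then obtain A' where A': "A' \<in> \<U> i" "z \<in> A'" and le: "d y z \<le> r"
        by (auto simp: step_rel_def)
      have "set_distance d A A' \<le> ereal (d y z)"
        unfolding set_distance_def using step.IH A'(2) by (intro INF_lower2[of "(y, z)"]) auto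
      also have "\<dots> \<le> ereal D" using le by (simp add: D_def le_max_iff_disj)
      finally have "A = A'"
        using \<U>(1) i A(1) A'(1) unfolding disjoint_family_at_def by (meson not_le)
      then show ?case using A'(2) by simp
    qed
    then have "d x y \<le> R i" using R i A by blast
    also have "\<dots> \<le> B" unfolding B_def using i by simp
    finally show "d x y \<le> B" .
  qed
  with \<U> show ?thesis
    unfolding chain_cover_def by (intro exI[of _ B] exI[of _ "\<lambda>i. \<Union>(\<U> i)"]) auto
qed

text \<open>The members of each family are the chain components of one colour; as steps are
  symmetric, these are equivalence classes.\<close>

lemma asdim_at_mostI:
  assumes "\<And>r. r > 0 \<Longrightarrow> \<exists>B. chain_cover d r B n M"
  shows "asdim_at_most M d n"
  unfolding asdim_at_most_def
proof (intro allI impI)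
  fix D :: real assume "0 < D"
  \<comment> \<open>The scale \<open>D + 1\<close> leaves room for the infimum: points of distinct
    components are at least \<open>D + 1\<close> apart, which makes the distance of the two sets
    strictly greater than \<open>D\<close>.\<close>
  then obtain B X where X: "M \<subseteq> (\<Union>i\<le>n. X i)" "\<And>i. i \<le> n \<Longrightarrow> X i \<subseteq> M"
      "\<And>i. i \<le> n \<Longrightarrow> chain_bounded d (D + 1) B (X i)"
    using assms[of "D + 1"] unfolding chain_cover_def by (auto, metis)
  define S where "S i = (step_rel d (D + 1) (X i))\<^sup>*" for i
  define \<U> where "\<U> i = (\<lambda>x. S i `` {x}) ` X i" for i
  have S_mem: "y \<in> X i" if "(x, y) \<in> S i" "x \<in> X i" for x y i
    using that step_rel_rtrancl_mem unfolding S_def by fast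
  have S_eq: "S i `` {x} = S i `` {y}" if "(x, y) \<in> S i" for x y i
  proof -
    have "(y, x) \<in> S i" using that sym_rtrancl[OF sym_step_rel] unfolding S_def by (rule symD[rotated])
    with that show ?thesis unfolding S_def by (auto intro: rtrancl_trans)
  qed
  have un: "\<Union>(\<U> i) = X i" for i
    using S_mem unfolding \<U>_def by (auto simp: S_def)
  have "uniformly_bounded_family d (\<U> i)" if i: "i \<le> n" for i
    unfolding uniformly_bounded_family_def
  proof (intro exI[of _ B] ballI)
    fix A x y assume "A \<in> \<U> i" "x \<in> A" "y \<in> A"
    then obtain a where a: "a \<in> X i" "(a, x) \<in> S i" "(a, y) \<in> S i" by (auto simp: \<U>_def)
    then have "(x, y) \<in> S i" using S_eq[OF a(2)] by auto
    then show "d x y \<le> B" using X(3)[OF i] S_mem a unfolding chain_bounded_def S_def by blast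
  qed
  moreover have "disjoint_family_at d D (\<U> i)" for i
    unfolding disjoint_family_at_def
  proof (intro ballI impI)
    fix A A' assume AA': "A \<in> \<U> i" "A' \<in> \<U> i" "A \<noteq> A'"
    have "D + 1 \<le> d u v" if uv: "u \<in> A" "v \<in> A'" for u v
    proof (rule ccontr)
      assume less: "\<not> ?thesis"
      obtain a a' where a: "a \<in> X i" "a' \<in> X i" "A = S i `` {a}" "A' = S i `` {a'}"
        using AA' by (auto simp: \<U>_def)
      then have "u \<in> X i" "v \<in> X i" using S_mem uv by auto
      then have "(u, v) \<in> S i"
        using less unfolding S_def by (intro r_into_rtrancl) (simp add: step_rel_def)
      then show False
        using S_eq[of a u i] S_eq[of a' v i] S_eq[of u v i] a uv AA'(3) by auto
    qed
    then have "ereal (D + 1) \<le> set_distance d A A'"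
      unfolding set_distance_def by (intro INF_greatest) auto
    moreover have "ereal D < ereal (D + 1)" by simp
    ultimately show "ereal D < set_distance d A A'" by (rule less_le_trans[rotated])
  qed
  ultimately show "\<exists>\<U> :: nat \<Rightarrow> 'a set set.
      (\<forall>i\<le>n. \<Union>(\<U> i) \<subseteq> M \<and> uniformly_bounded_family d (\<U> i) \<and> disjoint_family_at d D (\<U> i)) \<and>
      M \<subseteq> (\<Union>i\<le>n. \<Union>(\<U> i))"
    using X(1,2) by (intro exI[of _ \<U>]) (simp add: un)
qed

text \<open>A map that displaces points by at most \<open>T\<close> changes distances by at most
  \<open>2 * T\<close>, so colourings of \<open>A'\<close> pull back along it.\<close>

lemma asdim_at_most_pullback:
  assumes "asdim_at_most A' d n" and A: "A \<subseteq> M" and A': "A' \<subseteq> M"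
    and p: "\<And>x. x \<in> A \<Longrightarrow> p x \<in> A'" "\<And>x. x \<in> A \<Longrightarrow> d x (p x) \<le> T"
  shows "asdim_at_most A d n"
proof -
  interpret A: Metric_space A d using A by (rule subspace)
  interpret A': Metric_space A' d using A' by (rule subspace)
  have "d (p x) (p y) \<le> d x y + 2 * T" "d x y \<le> d (p x) (p y) + 2 * T" if "x \<in> A" "y \<in> A" for x y
  proof -
    have "x \<in> M" "y \<in> M" "p x \<in> M" "p y \<in> M" using that p(1) A A' by blast+
    then show "d (p x) (p y) \<le> d x y + 2 * T" "d x y \<le> d (p x) (p y) + 2 * T"
      using p(2)[OF that(1)] p(2)[OF that(2)] triangle[of "p x" x "p y"] triangle[of x y "p y"]
        triangle[of x "p x" y] triangle[of "p x" "p y" y] commute[of "p x" x] commute[of "p y" y]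
      by linarith+
  qed
  note cover = chain_cover_pullback[of d _ "2 * T" _ n A' A p, OF _ p(1) this]
  show ?thesis
  proof (rule A.asdim_at_mostI)
    fix r :: real
    show "\<exists>B. chain_cover d r B n A"
      using A'.asdim_at_most_imp_chain_cover[OF assms(1), of "r + 2 * T"] cover[of r] by blast
  qed
qed

section \<open>Merging colourings of neighbouring slabs\<close>

text \<open>
  Saturated union: since the pieces of \<open>A\<close> are too small to bridge the gap between two
  pieces of \<open>A'\<close>, a chain in the union meets at most one piece of \<open>A'\<close>.
\<close>

lemma chain_bounded_Un:
  assumes AM: "A \<subseteq> M" "A' \<subseteq> M" and r: "0 \<le> r" and B: "0 \<le> B" "0 \<le> B'"
    and A: "chain_bounded d r B A" and A': "chain_bounded d (B + 2 * r) B' A'"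
  shows "chain_bounded d r (B' + 2 * (B + r)) (A \<union> A')"
proof -
  \<comment> \<open>Here \<open>z\<close> is the last point of \<open>A'\<close> visited and
    \<open>u\<close> begins the excursion into \<open>A\<close> that follows. A return to
    \<open>A'\<close> lands within \<open>r + B + r\<close> of \<open>z\<close>, hence counts as one
    step at scale \<open>B + 2 * r\<close>.\<close>
  have from_A': "\<exists>z\<in>A'. (x, z) \<in> (step_rel d (B + 2 * r) A')\<^sup>* \<and>
      (y = z \<or> (y \<in> A \<and> (\<exists>u\<in>A. d z u \<le> r \<and> (u, y) \<in> (step_rel d r A)\<^sup>*)))"
    if "x \<in> A'" "(x, y) \<in> (step_rel d r (A \<union> A'))\<^sup>*" for x y
    using that(2)
  proof (induction rule: rtrancl_induct)
    case base
    then show ?case using that(1) by blast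
  next
    case (step y y')
    then obtain z where z: "z \<in> A'" "(x, z) \<in> (step_rel d (B + 2 * r) A')\<^sup>*"
      "y = z \<or> (y \<in> A \<and> (\<exists>u\<in>A. d z u \<le> r \<and> (u, y) \<in> (step_rel d r A)\<^sup>*))" by blast
    have y': "y' \<in> A \<or> y' \<in> A'" "d y y' \<le> r" "y \<in> A \<union> A'"
      using step.hyps(2) by (auto simp: step_rel_def)
    show ?case
    proof (cases "y' \<in> A'")
      case True
      have "d z y' \<le> B + 2 * r"
      proof (cases "y = z")
        case True
        then show ?thesis using y'(2) r B by simp
      next
        case False
        then obtain u where u: "y \<in> A" "u \<in> A" "d z u \<le> r" "(u, y) \<in> (step_rel d r A)\<^sup>*"
          using z(3) by blast
        then have "d u y \<le> B" using A unfolding chain_bounded_def by blast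
        moreover have "d z y' \<le> d z u + (d u y + d y y')"
          using triangle[of z u y'] triangle[of u y y'] z(1) u True AM by fastforce
        ultimately show ?thesis using u(3) y'(2) by linarith
      qed
      then have "(z, y') \<in> step_rel d (B + 2 * r) A'" using z(1) True by (simp add: step_rel_def)
      then have "(x, y') \<in> (step_rel d (B + 2 * r) A')\<^sup>*" by (rule rtrancl_into_rtrancl[OF z(2)])
      then show ?thesis using True by blast
    next
      case False
      then have y'A: "y' \<in> A" using y'(1) by blast
      show ?thesis
      proof (cases "y = z")
        case True
        then show ?thesis using z y'A y'(2) by blast
      next
        case False
        then obtain u where u: "y \<in> A" "u \<in> A" "d z u \<le> r" "(u, y) \<in> (step_rel d r A)\<^sup>*"
          using z(3) by blast
        then have "(u, y') \<in> (step_rel d r A)\<^sup>*"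
          using y'A y'(2) by (intro rtrancl_into_rtrancl[OF u(4)]) (simp add: step_rel_def)
        then show ?thesis using z u y'A by blast
      qed
    qed
  qed
  have bound: "d x y \<le> B' + (B + r)"
    if x: "x \<in> A'" and xy: "(x, y) \<in> (step_rel d r (A \<union> A'))\<^sup>*" for x y
  proof -
    obtain z where z: "z \<in> A'" "(x, z) \<in> (step_rel d (B + 2 * r) A')\<^sup>*"
      "y = z \<or> (y \<in> A \<and> (\<exists>u\<in>A. d z u \<le> r \<and> (u, y) \<in> (step_rel d r A)\<^sup>*))"
      using from_A'[OF x xy] by blast
    have xz: "d x z \<le> B'" using A' x z unfolding chain_bounded_def by blast
    show ?thesis
    proof (cases "y = z")
      case True
      then show ?thesis using xz B r by simp
    next
      case False
      then obtain u where u: "y \<in> A" "u \<in> A" "d z u \<le> r" "(u, y) \<in> (step_rel d r A)\<^sup>*"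
        using z(3) by blast
      then have "d u y \<le> B" using A unfolding chain_bounded_def by blast
      moreover have "d x y \<le> d x z + (d z u + d u y)"
        using triangle[of x z y] triangle[of z u y] x z(1) u AM by fastforce
      ultimately show ?thesis using u(3) xz by linarith
    qed
  qed
  \<comment> \<open>A chain starting in \<open>A\<close> stays in one component of \<open>A\<close>
    until it first leaves \<open>A\<close>, at a point \<open>p\<close> of \<open>A'\<close>. The
    total bound becomes \<open>(B + r) + (B' + (B + r))\<close>.\<close>
  have from_A: "(x, y) \<in> (step_rel d r A)\<^sup>* \<or>
      (\<exists>p\<in>A'. d x p \<le> B + r \<and> (p, y) \<in> (step_rel d r (A \<union> A'))\<^sup>*)"
    if x: "x \<in> A" and "(x, y) \<in> (step_rel d r (A \<union> A'))\<^sup>*" for x y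
    using that(2)
  proof (induction rule: rtrancl_induct)
    case base
    then show ?case by blast
  next
    case (step y y')
    from step.IH show ?case
    proof
      assume xy: "(x, y) \<in> (step_rel d r A)\<^sup>*"
      then have y: "y \<in> A" using x step_rel_rtrancl_mem by fast
      then have "d x y \<le> B" using A x xy unfolding chain_bounded_def by blast
      have y': "y' \<in> A \<union> A'" "d y y' \<le> r" using step.hyps(2) by (auto simp: step_rel_def)
      show ?thesis
      proof (cases "y' \<in> A")
        case True
        then have "(y, y') \<in> step_rel d r A" using y y' by (simp add: step_rel_def)
        then show ?thesis using rtrancl_into_rtrancl[OF xy] by blast
      next
        case False
        then have "y' \<in> A'" using y' by blast
        moreover have "d x y' \<le> B + r"
          using triangle[of x y y'] \<open>d x y \<le> B\<close> y' y x AM by fastforce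
        ultimately show ?thesis by blast
      qed
    next
      assume "\<exists>p\<in>A'. d x p \<le> B + r \<and> (p, y) \<in> (step_rel d r (A \<union> A'))\<^sup>*"
      then show ?thesis using rtrancl_into_rtrancl[OF _ step.hyps(2)] by blast
    qed
  qed
  show ?thesis unfolding chain_bounded_def
  proof (intro ballI impI)
    fix x y assume x: "x \<in> A \<union> A'" and y: "y \<in> A \<union> A'"
      and xy: "(x, y) \<in> (step_rel d r (A \<union> A'))\<^sup>*"
    show "d x y \<le> B' + 2 * (B + r)"
    proof (cases "x \<in> A'")
      case True
      then show ?thesis using bound[OF _ xy] B r by auto
    next
      case False
      then have xA: "x \<in> A" using x by blast
      from from_A[OF xA xy] show ?thesis
      proof
        assume *: "(x, y) \<in> (step_rel d r A)\<^sup>*"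
        then have "y \<in> A" using xA step_rel_rtrancl_mem by fast
        then have "d x y \<le> B" using A xA * unfolding chain_bounded_def by blast
        moreover have "0 \<le> B' + B + 2 * r" using B r by simp
        ultimately show ?thesis by (simp add: algebra_simps)
      next
        assume "\<exists>p\<in>A'. d x p \<le> B + r \<and> (p, y) \<in> (step_rel d r (A \<union> A'))\<^sup>*"
        then obtain p where p: "p \<in> A'" "d x p \<le> B + r" "(p, y) \<in> (step_rel d r (A \<union> A'))\<^sup>*"
          by blast
        have "d x y \<le> d x p + d p y" using triangle xA p(1) y AM by blast
        then show ?thesis using p(2) bound[OF p(1,3)] by simp
      qed
    qed
  qed
qed


text \<open>
  Even slabs are coloured at scale \<open>r\<close>, odd slabs at a scale exceeding the resulting bound; an
  interval of length \<open>R\<close> meets at most one slab of either kind.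
\<close>

lemma slabwise_colouring:
  fixes f :: "'a \<Rightarrow> int"
  assumes slabs: "\<And>r R. 0 \<le> R \<Longrightarrow> \<exists>B. \<forall>a. chain_cover d r B n {x \<in> M. a \<le> f x \<and> f x \<le> a + R}"
    and r: "0 \<le> r" and R: "0 \<le> R"
  shows "\<exists>B X. M \<subseteq> (\<Union>i\<le>n. X i) \<and>
    (\<forall>i\<le>n. X i \<subseteq> M \<and> (\<forall>a. chain_bounded d r B {x \<in> X i. a \<le> f x \<and> f x \<le> a + R}))"
proof -
  \<comment> \<open>Slabs are preimages of blocks of \<open>R + 1\<close> consecutive integers, so a
    window from \<open>a\<close> to \<open>a + R\<close> meets at most two of them, and these are
    adjacent.\<close>
  define slab where "slab j = {x \<in> M. f x div (R + 1) = j}" for j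
  have slab_eq: "slab j = {x \<in> M. (R + 1) * j \<le> f x \<and> f x \<le> (R + 1) * j + R}" for j
  proof -
    have "y div (R + 1) = j \<longleftrightarrow> (R + 1) * j \<le> y \<and> y \<le> (R + 1) * j + R" for y
    proof
      assume "y div (R + 1) = j"
      then have "(R + 1) * j + y mod (R + 1) = y" by (metis mult_div_mod_eq)
      then show "(R + 1) * j \<le> y \<and> y \<le> (R + 1) * j + R"
        using R pos_mod_sign[of "R + 1" y] pos_mod_bound[of "R + 1" y] by linarith
    next
      assume "(R + 1) * j \<le> y \<and> y \<le> (R + 1) * j + R"
      then show "y div (R + 1) = j"
        using R by (intro int_div_pos_eq[of _ _ _ "y - (R + 1) * j"]) auto
    qed
    then show ?thesis by (auto simp: slab_def)
  qed
  have cover: "\<exists>B\<ge>0. \<forall>j. chain_cover d s B n (slab j)" for s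
  proof -
    obtain B where "\<forall>a. chain_cover d s B n {x \<in> M. a \<le> f x \<and> f x \<le> a + R}"
      using slabs[OF R] by blast
    \<comment> \<open>Raising the bound to \<open>max B 0\<close> supplies the nonnegativity that
      \<open>chain_bounded_Un\<close> asks for.\<close>
    then have "\<forall>j. chain_cover d s (max B 0) n (slab j)"
      unfolding slab_eq by (blast intro: chain_cover_mono max.cobounded1)
    then show ?thesis by (intro exI[of _ "max B 0"]) simp
  qed
  obtain B1 where B1: "B1 \<ge> 0" "\<And>j. chain_cover d r B1 n (slab j)" using cover by meson
  obtain B2 where B2: "B2 \<ge> 0" "\<And>j. chain_cover d (B1 + 2 * r) B2 n (slab j)" using cover by meson
  have "\<forall>j. \<exists>X :: nat \<Rightarrow> 'a set. slab j \<subseteq> (\<Union>i\<le>n. X i) \<and>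
      (\<forall>i\<le>n. X i \<subseteq> slab j \<and> chain_bounded d r B1 (X i))"
    using B1(2) unfolding chain_cover_def by blast
  then obtain E :: "int \<Rightarrow> nat \<Rightarrow> 'a set"
    where "\<forall>j. slab j \<subseteq> (\<Union>i\<le>n. E j i) \<and> (\<forall>i\<le>n. E j i \<subseteq> slab j \<and> chain_bounded d r B1 (E j i))"
    by (rule choice[THEN exE])
  then have E: "\<And>j. slab j \<subseteq> (\<Union>i\<le>n. E j i)"
      "\<And>i j. i \<le> n \<Longrightarrow> E j i \<subseteq> slab j" "\<And>i j. i \<le> n \<Longrightarrow> chain_bounded d r B1 (E j i)"
    by blast+
  have "\<forall>j. \<exists>X :: nat \<Rightarrow> 'a set. slab j \<subseteq> (\<Union>i\<le>n. X i) \<and>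
      (\<forall>i\<le>n. X i \<subseteq> slab j \<and> chain_bounded d (B1 + 2 * r) B2 (X i))"
    using B2(2) unfolding chain_cover_def by blast
  then obtain O' :: "int \<Rightarrow> nat \<Rightarrow> 'a set"
    where "\<forall>j. slab j \<subseteq> (\<Union>i\<le>n. O' j i) \<and>
      (\<forall>i\<le>n. O' j i \<subseteq> slab j \<and> chain_bounded d (B1 + 2 * r) B2 (O' j i))"
    by (rule choice[THEN exE])
  then have O': "\<And>j. slab j \<subseteq> (\<Union>i\<le>n. O' j i)"
      "\<And>i j. i \<le> n \<Longrightarrow> O' j i \<subseteq> slab j" "\<And>i j. i \<le> n \<Longrightarrow> chain_bounded d (B1 + 2 * r) B2 (O' j i)"
    by blast+
  define X where "X i = (\<Union>j. if even j then E j i else O' j i)" for i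
  have "M \<subseteq> (\<Union>i\<le>n. X i)"
  proof
    fix x assume "x \<in> M"
    define j where "j = f x div (R + 1)"
    have "x \<in> slab j" using \<open>x \<in> M\<close> by (simp add: slab_def j_def)
    then have "\<exists>i\<le>n. x \<in> (if even j then E j i else O' j i)" using E(1)[of j] O'(1)[of j] by auto
    then show "x \<in> (\<Union>i\<le>n. X i)" unfolding X_def by blast
  qed
  moreover have "X i \<subseteq> M" if "i \<le> n" for i
    using E(2)[OF that] O'(2)[OF that] by (fastforce simp: X_def slab_def split: if_splits)
  moreover have "chain_bounded d r (B2 + 2 * (B1 + r)) {x \<in> X i. a \<le> f x \<and> f x \<le> a + R}"
    if i: "i \<le> n" for i a
  proof -
    define q where "q = a div (R + 1)"
    \<comment> \<open>\<open>e\<close> and \<open>o'\<close> are the even and the odd one among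
      \<open>q\<close> and \<open>q + 1\<close>, the only blocks that can meet the window.\<close>
    define e o' where "e = (if even q then q else q + 1)" and "o' = (if even q then q + 1 else q)"
    have "x \<in> E e i \<union> O' o' i" if x: "x \<in> X i" "a \<le> f x" "f x \<le> a + R" for x
    proof -
      obtain j where j: "x \<in> (if even j then E j i else O' j i)" using x(1) unfolding X_def by blast
      then have "x \<in> slab j" using E(2)[OF i] O'(2)[OF i] by (auto split: if_splits)
      then have jx: "j = f x div (R + 1)" by (simp add: slab_def)
      have "q \<le> j" unfolding q_def jx using R x(2) by (intro zdiv_mono1) auto
      moreover have "j \<le> (a + (R + 1)) div (R + 1)" unfolding jx using R x(3) by (intro zdiv_mono1) auto
      then have "j \<le> q + 1" using R by (simp add: q_def)
      ultimately have "j = q \<or> j = q + 1" by linarith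
      then show ?thesis using j by (auto simp: e_def o'_def split: if_splits)
    qed
    moreover have "E e i \<subseteq> M" "O' o' i \<subseteq> M"
      using E(2)[OF i] O'(2)[OF i] by (auto simp: slab_def)
    then have "chain_bounded d r (B2 + 2 * (B1 + r)) (E e i \<union> O' o' i)"
      by (rule chain_bounded_Un[OF _ _ r B1(1) B2(1) E(3)[OF i] O'(3)[OF i]])
    ultimately show ?thesis by (intro chain_bounded_mono[OF \<open>chain_bounded _ _ _ (_ \<union> _)\<close>]) auto
  qed
  ultimately show ?thesis by blast
qed

section \<open>Kolmogorov's trick for maps to the integers\<close>

text \<open>
  The sets \<open>X i\<close> are turned into \<open>n + 2\<close> sets, any point of \<open>M\<close> lying in at least two of them:
  thicken each \<open>X i\<close> and add the set \<open>W\<close> of points that lie in only one thickened set.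
  Removing from the \<open>i\<close>-th set the \<open>i\<close>-th of \<open>n + 2\<close> disjoint periodic families of gaps of \<open>\<int>\<close> still
  leaves a cover, and no chain crosses a gap.
\<close>

theorem asdim_at_most_fibering:
  fixes f :: "'a \<Rightarrow> int"
  assumes coarse: "\<And>r. \<exists>l. \<forall>x\<in>M. \<forall>y\<in>M. d x y \<le> r \<longrightarrow> \<bar>f x - f y\<bar> \<le> l"
    and slabs: "\<And>r R. 0 \<le> R \<Longrightarrow> \<exists>B. \<forall>a. chain_cover d r B n {x \<in> M. a \<le> f x \<and> f x \<le> a + R}"
  shows "asdim_at_most M d (Suc n)"
proof (rule asdim_at_mostI)
  fix r :: real assume r: "0 < r"
  obtain l0 where l0: "\<forall>x\<in>M. \<forall>y\<in>M. d x y \<le> r \<longrightarrow> \<bar>f x - f y\<bar> \<le> l0" using coarse by blast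
  define l where "l = max l0 0"
  have l: "\<bar>f x - f y\<bar> \<le> l" if "x \<in> M" "y \<in> M" "d x y \<le> r" for x y
    using l0 that unfolding l_def by fastforce
  have l_nn: "0 \<le> l" by (simp add: l_def)
  \<comment> \<open>A step of length at most \<open>r\<close> changes \<open>f\<close> by at most
    \<open>l\<close>, so it cannot cross a gap of \<open>l + 1\<close> integers. A period of length
    \<open>c\<close> holds \<open>n + 2\<close> such gaps side by side, one for each colour.\<close>
  define w where "w = l + 1"
  define c where "c = (int n + 2) * w"
  have w: "0 < w" and c: "0 < c" using l_nn by (auto simp: w_def c_def)
  \<comment> \<open>Thickening by \<open>r\<close> costs \<open>r\<close> at either end of a step
    and \<open>l\<close> at either end of a window; hence the scale \<open>3 * r\<close> and the
    window length \<open>c + 2 * l\<close>.\<close>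
  have "\<exists>B X. M \<subseteq> (\<Union>i\<le>n. X i) \<and> (\<forall>i\<le>n. X i \<subseteq> M \<and>
      (\<forall>a. chain_bounded d (3 * r) B {x \<in> X i. a \<le> f x \<and> f x \<le> a + (c + 2 * l)}))"
    by (rule slabwise_colouring, rule slabs, assumption) (use r c l_nn in simp_all)
  then obtain B X where X: "M \<subseteq> (\<Union>i\<le>n. X i)" "\<And>i. i \<le> n \<Longrightarrow> X i \<subseteq> M" and
    bd: "\<And>i a. i \<le> n \<Longrightarrow> chain_bounded d (3 * r) B {x \<in> X i. a \<le> f x \<and> f x \<le> a + (c + 2 * l)}"
    by (elim exE conjE) blast
  define X' where "X' i = {x \<in> M. \<exists>y\<in>X i. d x y \<le> r}" for i
  define W where "W = {x \<in> M. \<exists>!i. i \<le> n \<and> x \<in> X' i}"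
  define Y where "Y i = (if i \<le> n then X' i else W)" for i
  define I where "I a = {x \<in> M. a \<le> f x \<and> f x \<le> a + c}" for a
  have XX': "X i \<subseteq> X' i" if "i \<le> n" for i
    using X(2)[OF that] r by (force simp: X'_def)
  have bdX': "chain_bounded d r (B + 2 * r) (X' i \<inter> I a)" if i: "i \<le> n" for i a
  proof -
    define p where "p x = (SOME y. y \<in> X i \<and> d x y \<le> r)" for x
    have p: "p x \<in> X i" "d x (p x) \<le> r" if "x \<in> X' i" for x
      using someI_ex[of "\<lambda>y. y \<in> X i \<and> d x y \<le> r"] that by (auto simp: p_def X'_def)
    have pM: "x \<in> M" "p x \<in> M" if "x \<in> X' i" for x
      using p(1)[OF that] that X(2)[OF i] by (auto simp: X'_def)
    define A' where "A' = {x \<in> X i. a - l \<le> f x \<and> f x \<le> (a - l) + (c + 2 * l)}"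
    have A': "chain_bounded d (r + 2 * r) B A'" using bd[OF i, of "a - l"] unfolding A'_def by simp
    show ?thesis
    proof (rule chain_bounded_pullback[OF A', of _ p])
      fix x assume x: "x \<in> X' i \<inter> I a"
      then have "\<bar>f x - f (p x)\<bar> \<le> l" using p(2) pM by (intro l) auto
      then show "p x \<in> A'" using x p(1) by (auto simp: A'_def I_def)
    next
      fix x y assume "x \<in> X' i \<inter> I a" "y \<in> X' i \<inter> I a"
      then have xy: "x \<in> X' i" "y \<in> X' i" by auto
      show "d (p x) (p y) \<le> d x y + 2 * r" "d x y \<le> d (p x) (p y) + 2 * r"
        using p(2)[OF xy(1)] p(2)[OF xy(2)] pM[OF xy(1)] pM[OF xy(2)]
          triangle[of "p x" x "p y"] triangle[of x y "p y"] triangle[of x "p x" y]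
          triangle[of "p x" "p y" y] commute[of "p x" x] commute[of "p y" y]
        by linarith+
    qed
  qed
  \<comment> \<open>A point of \<open>W\<close> lies in some \<open>X k\<close>, and
    \<open>k\<close> must be its only thickened index. A step of length at most \<open>r\<close>
    from it ends in \<open>X' k\<close>, so a chain in \<open>W\<close> never changes its index and
    inherits the bound for \<open>X' k\<close>.\<close>
  have bdW: "chain_bounded d r (B + 2 * r) (W \<inter> I a)" for a
    unfolding chain_bounded_def
  proof (intro ballI impI)
    fix x y assume x: "x \<in> W \<inter> I a" and y: "y \<in> W \<inter> I a"
      and xy: "(x, y) \<in> (step_rel d r (W \<inter> I a))\<^sup>*"
    have W_X: "u \<in> X i" if "u \<in> W" "i \<le> n" "u \<in> X' i" for u i
    proof -
      have "u \<in> M" using that(1) by (simp add: W_def)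
      then obtain k where k: "k \<le> n" "u \<in> X k" using X(1) by blast
      then have "u \<in> X' k" using XX' by blast
      then have "k = i" using that k(1) by (auto simp: W_def)
      then show ?thesis using k by simp
    qed
    obtain i where i: "i \<le> n" "x \<in> X' i" using x by (auto simp: W_def)
    from xy have "(x, y) \<in> (step_rel d r (X' i \<inter> I a))\<^sup>* \<and> y \<in> X' i"
    proof (induction rule: rtrancl_induct)
      case base
      show ?case using i by simp
    next
      case (step u v)
      have uv: "u \<in> W" "u \<in> I a" "v \<in> W" "v \<in> I a" "d u v \<le> r"
        using step.hyps(2) by (auto simp: step_rel_def)
      have "u \<in> X i" using W_X[OF uv(1) i(1)] step.IH by simp
      then have v: "v \<in> X' i" using uv by (auto simp: X'_def W_def commute)
      then have "(u, v) \<in> step_rel d r (X' i \<inter> I a)" using uv step.IH by (simp add: step_rel_def)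
      with v show ?case using rtrancl_into_rtrancl[OF conjunct1[OF step.IH]] by blast
    qed
    moreover have "x \<in> X' i \<inter> I a" "y \<in> X' i \<inter> I a" using calculation i(2) x y by auto
    ultimately show "d x y \<le> B + 2 * r"
      using bdX'[OF i(1), of a] unfolding chain_bounded_def by blast
  qed
  have bdY: "chain_bounded d r (B + 2 * r) (Y i \<inter> I a)" for i a
    using bdX' bdW by (simp add: Y_def)
  have YM: "Y i \<subseteq> M" for i unfolding Y_def X'_def W_def by (simp add: subset_iff)
  \<comment> \<open>The second index is \<open>Suc n\<close> for a point of \<open>W\<close>; any
    other point lies in a second thickened set.\<close>
  have Y_twice: "\<exists>i j. i \<le> Suc n \<and> j \<le> Suc n \<and> i \<noteq> j \<and> x \<in> Y i \<and> x \<in> Y j"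
    if x: "x \<in> M" for x
  proof -
    obtain k where "k \<le> n" "x \<in> X k" using X(1) x by blast
    then have k: "k \<le> n" "x \<in> X' k" using XX'[of k] by auto
    show ?thesis
    proof (cases "x \<in> W")
      case True
      then show ?thesis using k by (intro exI[of _ k] exI[of _ "Suc n"]) (simp add: Y_def)
    next
      case False
      then have "\<not> (\<exists>!i. i \<le> n \<and> x \<in> X' i)" using x by (simp add: W_def)
      then obtain j where j: "j \<le> n" "x \<in> X' j" "j \<noteq> k" using k by blast
      then show ?thesis using k by (intro exI[of _ k] exI[of _ j]) (simp add: Y_def)
    qed
  qed
  \<comment> \<open>\<open>V i\<close> is what remains of the integers after removing the
    \<open>i\<close>-th gaps, which occupy the residues from \<open>i * w\<close> to
    \<open>i * w + w - 1\<close> modulo \<open>c\<close>.\<close>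
  define V where "V i = {y :: int. w \<le> (y - int i * w) mod c}" for i :: nat
  define Z where "Z i = {x \<in> Y i. f x \<in> V i}" for i
  have V_miss: "i = j" if "i \<le> Suc n" "j \<le> Suc n" "y \<notin> V i" "y \<notin> V j" for i j y
  proof -
    \<comment> \<open>The number of the gap containing \<open>y\<close> can be read off from
      \<open>y\<close>, so different gaps are disjoint and a point loses at most one of its two
      sets.\<close>
    have index: "int k = (y mod c) div w" if "k \<le> Suc n" "y \<notin> V k" for k
    proof -
      define s where "s = (y - int k * w) mod c"
      have s: "0 \<le> s" "s < w" using that(2) c by (auto simp: V_def s_def)
      have "int k * w + w \<le> c"
        using mult_right_mono[of "int k + 1" "int n + 2" w] that(1) w by (simp add: c_def algebra_simps)
      then have "(int k * w + s) mod c = int k * w + s" using s w by (intro mod_pos_pos_trivial) auto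
      moreover have "(int k * w + s) mod c = y mod c" by (simp add: s_def mod_add_right_eq)
      ultimately have "y mod c = int k * w + s" by simp
      then show ?thesis using s by simp
    qed
    show ?thesis using index[OF that(1,3)] index[OF that(2,4)] by simp
  qed
  have "M \<subseteq> (\<Union>i\<le>Suc n. Z i)"
  proof
    fix x assume "x \<in> M"
    from Y_twice[OF this] obtain i j
      where "i \<le> Suc n" "j \<le> Suc n" "i \<noteq> j" "x \<in> Y i" "x \<in> Y j" by blast
    then have "x \<in> Z i \<or> x \<in> Z j" using V_miss[of i j "f x"] by (auto simp: Z_def)
    then show "x \<in> (\<Union>i\<le>Suc n. Z i)" using \<open>i \<le> Suc n\<close> \<open>j \<le> Suc n\<close> by blast
  qed
  moreover have "Z i \<subseteq> M" for i using YM by (auto simp: Z_def)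
  moreover have "chain_bounded d r (B + 2 * r) (Z i)" for i
    unfolding chain_bounded_def
  proof (intro ballI impI)
    fix x y assume x: "x \<in> Z i" and y: "y \<in> Z i" and xy: "(x, y) \<in> (step_rel d r (Z i))\<^sup>*"
    \<comment> \<open>\<open>q u\<close> numbers the period, shifted by \<open>i * w\<close>, that
      contains \<open>f u\<close>. Each period begins with its gap, so a point of \<open>Z i\<close>
      in a later period is more than \<open>w\<close> beyond one in an earlier period.\<close>
    define q where "q u = (f u - int i * w) div c" for u
    have no_jump: "q v \<le> q u" if "u \<in> Z i" "v \<in> Z i" "d u v \<le> r" for u v
    proof (rule ccontr)
      assume "\<not> q v \<le> q u"
      then have "c * (q u + 1) \<le> c * q v" using c by (intro mult_left_mono) auto
      moreover have "f u - int i * w < c * q u + c"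
        using c mult_div_mod_eq[of c "f u - int i * w"] pos_mod_bound[of c "f u - int i * w"]
        unfolding q_def by linarith
      moreover have "w \<le> (f v - int i * w) mod c" using that(2) by (simp add: Z_def V_def)
      then have "c * q v + w \<le> f v - int i * w"
        using mult_div_mod_eq[of c "f v - int i * w"] unfolding q_def by linarith
      moreover have "\<bar>f u - f v\<bar> \<le> l" using that YM by (intro l) (auto simp: Z_def)
      ultimately show False unfolding w_def by (simp add: algebra_simps)
    qed
    define a where "a = int i * w + c * q x"
    have in_I: "u \<in> I a" if u: "u \<in> Z i" "q u = q x" for u
    proof -
      have "c * q u + (f u - int i * w) mod c = f u - int i * w" by (simp add: q_def)
      then have "f u = a + (f u - int i * w) mod c" unfolding u(2) a_def by linarith
      then have "a \<le> f u" "f u \<le> a + c"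
        using pos_mod_bound[OF c, of "f u - int i * w"] pos_mod_sign[OF c, of "f u - int i * w"]
        by linarith+
      then show ?thesis using u(1) YM by (auto simp: I_def Z_def)
    qed
    \<comment> \<open>A chain thus stays in one period, that is in one window \<open>I a\<close>,
      where \<open>Y i\<close> is already bounded.\<close>
    from xy have "(x, y) \<in> (step_rel d r (Y i \<inter> I a))\<^sup>* \<and> q y = q x"
    proof (induction rule: rtrancl_induct)
      case base
      show ?case by simp
    next
      case (step u v)
      have uv: "u \<in> Z i" "v \<in> Z i" "d u v \<le> r" using step.hyps(2) by (auto simp: step_rel_def)
      have qv: "q v = q x" using no_jump[of u v] no_jump[of v u] uv step.IH by (simp add: commute)
      then have "(u, v) \<in> step_rel d r (Y i \<inter> I a)"
        using uv in_I[of u] in_I[of v] step.IH by (auto simp: step_rel_def Z_def)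
      with qv show ?case using rtrancl_into_rtrancl[OF conjunct1[OF step.IH]] by blast
    qed
    moreover have "x \<in> Y i \<inter> I a" "y \<in> Y i \<inter> I a"
      using x y in_I calculation by (auto simp: Z_def)
    ultimately show "d x y \<le> B + 2 * r" using bdY unfolding chain_bounded_def by blast
  qed
  ultimately show "\<exists>B. chain_cover d r B (Suc n) M"
    unfolding chain_cover_def by (intro exI[of _ "B + 2 * r"] exI[of _ Z]) auto
qed

end

section \<open>Cyclic extensions\<close>

text \<open>Either the powers of a generator are distinct and give the isomorphism, or two of them
  coincide, a positive power is trivial, and exponents reduce modulo that power.\<close>

lemma (in group) cyclic_group_finite_or_integer:
  assumes "cyclic_group G"
  shows "finite (carrier G) \<or> G \<cong> integer_group"
proof -
  obtain x where x: "x \<in> carrier G" "carrier G = range (\<lambda>n::int. x [^] n)"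
    using assms by (auto simp: cyclic_group)
  show ?thesis
  proof (cases "inj (\<lambda>n::int. x [^] n)")
    case True
    have "(\<lambda>n::int. x [^] n) \<in> hom integer_group G" using x(1) by (rule hom_integer_group_pow)
    then have "(\<lambda>n::int. x [^] n) \<in> iso integer_group G"
      using True x(2) by (auto simp: iso_def bij_betw_def)
    then have "integer_group \<cong> G" by (auto simp: is_iso_def)
    then show ?thesis using group.iso_sym[OF group_integer_group] by blast
  next
    case False
    then obtain i j :: int where ij: "i < j" "x [^] i = x [^] j"
      unfolding inj_def by (metis linorder_neqE)
    define m where "m = j - i"
    have m: "0 < m" "x [^] m = \<one>" using ij x(1) by (simp_all add: m_def int_pow_diff)
    have "x [^] n \<in> (\<lambda>n. x [^] n) ` {0..<m}" for n :: int
    proof -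
      have "x [^] n = x [^] (m * (n div m) + n mod m)" by simp
      also have "\<dots> = (x [^] m) [^] (n div m) \<otimes> x [^] (n mod m)"
        using x(1) by (simp only: int_pow_mult int_pow_pow)
      also have "\<dots> = x [^] (n mod m)" using x(1) m(2) by simp
      finally show ?thesis using m(1) by (intro image_eqI[of _ _ "n mod m"]) auto
    qed
    then have "carrier G \<subseteq> (\<lambda>n. x [^] n) ` {0..<m}" using x(2) by auto
    then show ?thesis by (meson finite_atLeastLessThan_int finite_imageI finite_subset)
  qed
qed

text \<open>There are only finitely many words of length at most \<open>k\<close> over a finite
  alphabet. This is what makes homomorphisms to the integers coarsely Lipschitz.\<close>

lemma (in group) finite_word_ball:
  assumes "finite S" "S \<subseteq> carrier G" "generate G S = carrier G"
  shows "finite {x \<in> carrier G. word_length G S x \<le> k}"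
proof -
  let ?W = "{ws. set ws \<subseteq> S \<union> m_inv G ` S \<and> length ws \<le> k}"
  have "{x \<in> carrier G. word_length G S x \<le> k} \<subseteq> (\<lambda>ws. foldr (mult G) ws \<one>) ` ?W"
  proof
    fix x assume x: "x \<in> {x \<in> carrier G. word_length G S x \<le> k}"
    then obtain ws where "is_word S ws x" "length ws = word_length G S x"
      using word_length_attained[OF assms(2,3)] by blast
    then show "x \<in> (\<lambda>ws. foldr (mult G) ws \<one>) ` ?W"
      using x by (intro image_eqI[of _ _ ws]) (auto simp: is_word_def)
  qed
  moreover have "finite ?W" using assms(1) by (intro finite_lists_length_le) simp
  ultimately show ?thesis by (meson finite_imageI finite_subset)
qed

lemma (in group) word_dist_left_mult:
  assumes "g \<in> carrier G" "x \<in> carrier G" "y \<in> carrier G"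
  shows "word_dist G S (g \<otimes> x) (g \<otimes> y) = word_dist G S x y"
proof -
  have "inv (g \<otimes> x) \<otimes> (g \<otimes> y) = inv x \<otimes> y"
    using assms by (simp add: inv_mult_group m_assoc flip: m_assoc[of "inv g" g y])
  then show ?thesis using assms by (simp add: word_dist_def)
qed

text \<open>Left translations preserve distances, whereas right multiplication by \<open>t\<close>
  displaces every point by the same amount; the infinite cyclic extension combines the two.\<close>

lemma (in group) word_dist_right_mult:
  assumes "x \<in> carrier G" "t \<in> carrier G"
  shows "word_dist G S x (x \<otimes> t) = word_length G S t"
  using assms by (simp add: word_dist_def flip: m_assoc)

section \<open>Finite and infinite cyclic extensions\<close>

context group
begin

context
  fixes S
  assumes fin: "finite S" and S: "S \<subseteq> carrier G" "generate G S = carrier G"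
begin

interpretation word_metric: Metric_space "carrier G" "word_dist G S"
  using S by (rule Metric_space_word_dist)

text \<open>Right multiplication by the inverse of a coset representative brings \<open>x\<close>
  into \<open>H\<close>, and the displacement is the word length of that representative, one of
  finitely many.\<close>

lemma asdim_at_most_finite_extension:
  assumes H: "subgroup H G" and L: "subgroup L G" and HL: "H \<subseteq> L"
    and fin_idx: "finite (rcosets\<^bsub>G\<lparr>carrier := L\<rparr>\<^esub> H)"
    and "asdim_at_most H (word_dist G S) n"
  shows "asdim_at_most L (word_dist G S) n"
proof -
  define \<sigma> where "\<sigma> C = (SOME t. t \<in> C)" for C :: "'a set"
  \<comment> \<open>The sum serves as a common bound for its nonnegative terms.\<close>
  define T where "T = (\<Sum>C\<in>rcosets\<^bsub>G\<lparr>carrier := L\<rparr>\<^esub> H. word_length G S (\<sigma> C))"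
  define p where "p x = x \<otimes> inv (\<sigma> (H #> x))" for x
  have HG: "H \<subseteq> carrier G" "L \<subseteq> carrier G" using H L subgroup.subset by blast+
  have *: "p x \<in> H \<and> word_dist G S x (p x) \<le> real T" if x: "x \<in> L" for x
  proof -
    have xG: "x \<in> carrier G" using x HG by blast
    have "H #> x \<in> rcosets\<^bsub>G\<lparr>carrier := L\<rparr>\<^esub> H" using x by (auto simp: RCOSETS_def r_coset_def)
    then have le: "word_length G S (\<sigma> (H #> x)) \<le> T"
      unfolding T_def using fin_idx by (intro member_le_sum) auto
    have "x \<in> H #> x" using rcos_self[OF xG H] .
    then have "\<sigma> (H #> x) \<in> H #> x" unfolding \<sigma>_def by (rule someI)
    then obtain h where h: "h \<in> H" "\<sigma> (H #> x) = h \<otimes> x" by (auto simp: r_coset_def)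
    have hG: "h \<in> carrier G" using h HG by blast
    have px: "p x = inv h" using hG xG by (simp add: p_def h(2) inv_mult_group flip: m_assoc)
    then have "p x \<in> H" using h(1) H by (simp add: subgroup.m_inv_closed)
    have "x = p x \<otimes> (h \<otimes> x)" using hG xG by (simp add: px flip: m_assoc)
    then have "word_dist G S (p x) x = word_length G S (h \<otimes> x)"
      using word_dist_right_mult[of "p x" "h \<otimes> x" S] hG xG px by simp
    then show ?thesis using \<open>p x \<in> H\<close> le h(2) by (simp add: word_metric.commute)
  qed
  show ?thesis
    by (rule word_metric.asdim_at_most_pullback[OF assms(5) HG(2,1), of p T]) (use * in auto)
qed

text \<open>All slabs of a given length reduce to the kernel with the same bounds: a left
  translation by a power of \<open>t\<close> moves a slab over an interval starting at 0, and right
  multiplication by finitely many powers of \<open>t\<close> then carries it into the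
  kernel.\<close>

lemma asdim_at_most_integer_extension:
  fixes f :: "'a \<Rightarrow> int"
  assumes L: "subgroup L G" and f: "f \<in> hom (G\<lparr>carrier := L\<rparr>) integer_group"
    and t: "t \<in> L" "f t = 1"
    and H: "asdim_at_most {x \<in> L. f x = 0} (word_dist G S) n"
  shows "asdim_at_most L (word_dist G S) (Suc n)"
proof -
  have LG: "L \<subseteq> carrier G" using L by (rule subgroup.subset)
  interpret L: Metric_space L "word_dist G S" using LG by (rule word_metric.subspace)
  interpret H: Metric_space "{x \<in> L. f x = 0}" "word_dist G S"
    using LG by (intro word_metric.subspace) auto
  interpret f: group_hom "G\<lparr>carrier := L\<rparr>" integer_group f
    using f by (simp add: group_hom_def group_hom_axioms_def subgroup.subgroup_is_group[OF L] group_axioms)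
  have f_mult: "f (x \<otimes> y) = f x + f y" if "x \<in> L" "y \<in> L" for x y
    using f.hom_mult[of x y] that by simp
  have mult_L: "x \<otimes> y \<in> L" if "x \<in> L" "y \<in> L" for x y
    using subgroup.m_closed[OF L] that .
  have inv_L: "inv x \<in> L" if "x \<in> L" for x
    using subgroup.m_inv_closed[OF L] that .
  have pow_L: "t [^] k \<in> L" and f_pow: "f (t [^] k) = k" for k :: int
  proof -
    have eq: "t [^] k = t [^]\<^bsub>G\<lparr>carrier := L\<rparr>\<^esub> k" using int_pow_consistent[OF L t(1)] .
    then show "t [^] k \<in> L" using f.G.int_pow_closed[of t k] t(1) by simp
    show "f (t [^] k) = k" unfolding eq using f.hom_int_pow[of t k] t by simp
  qed
  have carrier: "t [^] k \<in> carrier G" for k :: int using pow_L LG by blast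
  show ?thesis
  proof (rule L.asdim_at_most_fibering)
    fix r :: real
    \<comment> \<open>The difference \<open>f y - f x\<close> is the value of \<open>f\<close> at
      \<open>inv x \<otimes> y\<close>, which lies in this finite ball when \<open>x\<close> and
      \<open>y\<close> are at distance at most \<open>r\<close>.\<close>
    let ?A = "{x \<in> carrier G. word_length G S x \<le> nat \<lfloor>r\<rfloor>}"
    define l where "l = (\<Sum>x\<in>?A. \<bar>f x\<bar>)"
    have "\<bar>f x - f y\<bar> \<le> l" if "x \<in> L" "y \<in> L" "word_dist G S x y \<le> r" for x y
    proof -
      have xy: "x \<in> carrier G" "y \<in> carrier G" "inv x \<otimes> y \<in> L"
        using that LG mult_L inv_L by blast+
      have "real (word_length G S (inv x \<otimes> y)) \<le> r"
        using that(3) xy by (simp add: word_dist_def)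
      then have "inv x \<otimes> y \<in> ?A" using xy by (simp add: le_nat_floor)
      then have "\<bar>f (inv x \<otimes> y)\<bar> \<le> l"
        unfolding l_def using finite_word_ball[OF fin S] by (intro member_le_sum) auto
      moreover have "f y = f x + f (inv x \<otimes> y)"
        using f_mult[OF that(1) xy(3)] xy by (simp flip: m_assoc)
      ultimately show ?thesis by linarith
    qed
    then show "\<exists>l. \<forall>x\<in>L. \<forall>y\<in>L. word_dist G S x y \<le> r \<longrightarrow> \<bar>f x - f y\<bar> \<le> l" by blast
  next
    fix r :: real and R :: int
    \<comment> \<open>The exponents \<open>f x - a\<close> range over \<open>0, ..., R\<close> on a
      slab, so \<open>T\<close> and hence \<open>B\<close> do not depend on
      \<open>a\<close>.\<close>
    define T where "T = real (\<Sum>k\<in>{0..R}. word_length G S (t [^] (- k)))"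
    obtain B where B: "chain_cover (word_dist G S) (r + 2 * T) B n {x \<in> L. f x = 0}"
      using H.asdim_at_most_imp_chain_cover[OF H] by blast
    have "chain_cover (word_dist G S) r (B + 2 * T) n {x \<in> L. a \<le> f x \<and> f x \<le> a + R}" for a
    proof -
      \<comment> \<open>\<open>q\<close> is an isometry that shifts \<open>f\<close> by
        \<open>- a\<close>; \<open>p\<close> then displaces \<open>q x\<close> by at most
        \<open>T\<close> on the slab, which gives the error \<open>2 * T\<close>.\<close>
      define q where "q x = t [^] (- a) \<otimes> x" for x
      define p where "p x = q x \<otimes> t [^] (- (f x - a))" for x
      have q: "q x \<in> L" "f (q x) = f x - a" if "x \<in> L" for x
        using that mult_L f_mult pow_L f_pow by (auto simp: q_def)
      have p: "p x \<in> L" "f (p x) = 0" if "x \<in> L" for x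
        using that mult_L f_mult pow_L f_pow q by (auto simp: p_def)
      have q_p: "word_dist G S (q x) (p x) \<le> T" if "x \<in> L" "a \<le> f x" "f x \<le> a + R" for x
      proof -
        have "word_dist G S (q x) (p x) = word_length G S (t [^] (- (f x - a)))"
          unfolding p_def using q(1)[OF that(1)] LG carrier by (intro word_dist_right_mult) auto
        also have "\<dots> \<le> T" unfolding T_def of_nat_le_iff
          using that by (intro member_le_sum[of "f x - a" _ "\<lambda>k. word_length G S (t [^] (- k))"]) auto
        finally show ?thesis .
      qed
      have q_q: "word_dist G S (q x) (q y) = word_dist G S x y" if "x \<in> L" "y \<in> L" for x y
        unfolding q_def using that LG carrier by (intro word_dist_left_mult) auto
      show ?thesis
      proof (rule chain_cover_pullback[OF B, of _ p])
        fix x assume "x \<in> {x \<in> L. a \<le> f x \<and> f x \<le> a + R}"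
        then show "p x \<in> {x \<in> L. f x = 0}" using p by auto
      next
        fix x y
        assume "x \<in> {x \<in> L. a \<le> f x \<and> f x \<le> a + R}" "y \<in> {x \<in> L. a \<le> f x \<and> f x \<le> a + R}"
        then have xy: "x \<in> L" "y \<in> L" "word_dist G S (q x) (p x) \<le> T" "word_dist G S (q y) (p y) \<le> T"
          using q_p by auto
        note mem = q(1)[OF xy(1)] q(1)[OF xy(2)] p(1)[OF xy(1)] p(1)[OF xy(2)]
        show "word_dist G S (p x) (p y) \<le> word_dist G S x y + 2 * T"
          "word_dist G S x y \<le> word_dist G S (p x) (p y) + 2 * T"
          unfolding q_q[OF xy(1,2), symmetric]
          using xy(3,4) mem L.triangle[of "p x" "q x" "p y"] L.triangle[of "q x" "q y" "p y"]
            L.triangle[of "q x" "p x" "q y"] L.triangle[of "p x" "p y" "q y"]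
            L.commute[of "p x" "q x"] L.commute[of "p y" "q y"]
          by linarith+
      qed
    qed
    then show "\<exists>B. \<forall>a. chain_cover (word_dist G S) r B n {x \<in> L. a \<le> f x \<and> f x \<le> a + R}"
      by blast
  qed
qed

text \<open>The quotient map followed by the isomorphism is a homomorphism to the integers with
  kernel \<open>H\<close>, and surjectivity supplies an element of value 1.\<close>

lemma asdim_at_most_infinite_cyclic_extension:
  assumes L: "subgroup L G" and N: "H \<lhd> G\<lparr>carrier := L\<rparr>"
    and iso: "(G\<lparr>carrier := L\<rparr>) Mod H \<cong> integer_group"
    and H: "asdim_at_most H (word_dist G S) n"
  shows "asdim_at_most L (word_dist G S) (Suc n)"
proof -
  let ?L = "G\<lparr>carrier := L\<rparr>"
  interpret N: normal H ?L by (rule N)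
  interpret Q: group "?L Mod H" by (rule N.factorgroup_is_group)
  obtain \<phi> where \<phi>: "\<phi> \<in> hom (?L Mod H) integer_group" "bij_betw \<phi> (carrier (?L Mod H)) UNIV"
    using iso by (auto simp: is_iso_def iso_def)
  define f where "f x = \<phi> (H #>\<^bsub>?L\<^esub> x)" for x
  have "f = \<phi> \<circ> (\<lambda>x. H #>\<^bsub>?L\<^esub> x)" by (simp add: fun_eq_iff f_def)
  then have f: "f \<in> hom ?L integer_group"
    using Group.hom_compose[OF N.r_coset_hom_Mod \<phi>(1)] by (simp only:)
  have "1 \<in> \<phi> ` carrier (?L Mod H)" using \<phi>(2) by (simp add: bij_betw_def)
  then obtain t where t: "t \<in> L" "f t = 1" by (auto simp: carrier_FactGroup f_def)
  have "\<phi> H = 0"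
    using group_hom.hom_one[of "?L Mod H" integer_group \<phi>] \<phi>(1) Q.is_group
    by (simp add: group_hom_def group_hom_axioms_def)
  have "x \<in> H \<longleftrightarrow> x \<in> L \<and> f x = 0" for x
  proof
    assume x: "x \<in> H"
    then show "x \<in> L \<and> f x = 0"
      using N.subset N.rcos_const[OF N.is_group x] \<open>\<phi> H = 0\<close> by (auto simp: f_def)
  next
    assume x: "x \<in> L \<and> f x = 0"
    have "H #>\<^bsub>?L\<^esub> x \<in> carrier (?L Mod H)" "H \<in> carrier (?L Mod H)"
      using x Q.one_closed by (auto simp: carrier_FactGroup)
    then have "H #>\<^bsub>?L\<^esub> x = H"
      using x \<phi>(2) \<open>\<phi> H = 0\<close> by (auto simp: f_def bij_betw_def inj_on_def)
    then show "x \<in> H" using N.rcos_self[of x H] N.subgroup_axioms x by auto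
  qed
  then have "H = {x \<in> L. f x = 0}" by blast
  then show ?thesis using asdim_at_most_integer_extension[OF L f t] H by simp
qed

section \<open>Induction along a polycyclic series\<close>

text \<open>Since every term keeps the metric of \<open>G\<close>, the two extension lemmas can be
  chained. A cyclic factor not isomorphic to the integers is finite and leaves both the bound and
  the count unchanged.\<close>

lemma asdim_at_most_polycyclic_series:
  assumes series: "polycyclic_series G n H" and "m \<le> n"
  shows "asdim_at_most (H m) (word_dist G S) (infinite_cyclic_factors G m H)"
  using assms(2)
proof (induction m)
  case 0
  have H0: "H 0 = {\<one>}" using series by (simp add: polycyclic_series_def)
  have "Metric_space {\<one>} (word_dist G S)" by (intro word_metric.subspace) simp
  then have "asdim_at_most {\<one>} (word_dist G S) 0"
  proof (rule Metric_space.asdim_at_mostI)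
    fix r
    show "\<exists>B. chain_cover (word_dist G S) r B 0 {\<one>}"
      unfolding chain_cover_def chain_bounded_def
      by (intro exI[of _ 0] exI[of _ "\<lambda>_. {\<one>}"]) auto
  qed
  then show ?case by (simp add: H0 infinite_cyclic_factors_def)
next
  case (Suc m)
  have sub: "subgroup (H m) G" "subgroup (H (Suc m)) G"
    using series Suc.prems by (simp_all add: polycyclic_series_def)
  have N: "H m \<lhd> G\<lparr>carrier := H (Suc m)\<rparr>" and cyc: "cyclic_group (factor_group G H m)"
    using series Suc.prems by (simp_all add: polycyclic_series_def)
  have IH: "asdim_at_most (H m) (word_dist G S) (infinite_cyclic_factors G m H)"
    using Suc by simp
  have set_eq: "{i. i < Suc m \<and> factor_group G H i \<cong> integer_group} =
      {i. i < m \<and> factor_group G H i \<cong> integer_group} \<union>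
      (if factor_group G H m \<cong> integer_group then {m} else {})"
    by (auto simp: less_Suc_eq)
  show ?case
  proof (cases "factor_group G H m \<cong> integer_group")
    case True
    then have "infinite_cyclic_factors G (Suc m) H = Suc (infinite_cyclic_factors G m H)"
      unfolding infinite_cyclic_factors_def set_eq by simp
    then show ?thesis
      using asdim_at_most_infinite_cyclic_extension[OF sub(2) N _ IH] True
      by (simp add: factor_group_def)
  next
    case False
    interpret Q: group "factor_group G H m"
      unfolding factor_group_def using N by (rule normal.factorgroup_is_group)
    have "finite (rcosets\<^bsub>G\<lparr>carrier := H (Suc m)\<rparr>\<^esub> H m)"
      using Q.cyclic_group_finite_or_integer[OF cyc] False by (simp add: factor_group_def FactGroup_def)
    moreover have "H m \<subseteq> H (Suc m)"
      using N subgroup.subset[of "H m"] by (fastforce simp: normal_def)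
    ultimately have "asdim_at_most (H (Suc m)) (word_dist G S) (infinite_cyclic_factors G m H)"
      using asdim_at_most_finite_extension[OF sub] IH by blast
    moreover have "infinite_cyclic_factors G (Suc m) H = infinite_cyclic_factors G m H"
      using False unfolding infinite_cyclic_factors_def set_eq by simp
    ultimately show ?thesis by simp
  qed
qed

end

end

theorem theorem8:
  fixes G :: "('a, 'b) monoid_scheme" and S :: "'a set"
  assumes "group G"
    and "finite S" and "S \<subseteq> carrier G" and "generate G S = carrier G"
    and "polycyclic G"
  shows "asdim (carrier G) (word_dist G S) \<le> enat (hirsch_length G)"
proof -
  interpret group G by (rule assms(1))
  \<comment> \<open>As some series exists, the least count is attained, and the bound is applied to
    a series realising it.\<close>
  have "\<exists>k n H. polycyclic_series G n H \<and> infinite_cyclic_factors G n H = k"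
    using assms(5) by (auto simp: polycyclic_def)
  from LeastI_ex[OF this] obtain n H
    where H: "polycyclic_series G n H" "infinite_cyclic_factors G n H = hirsch_length G"
    unfolding hirsch_length_def by blast
  then have "H n = carrier G" by (simp add: polycyclic_series_def)
  then show ?thesis
    using asdim_at_most_polycyclic_series[OF assms(2-4) H(1) order_refl] H(2)
    by (simp add: asdim_le_enat_iff)
qed

end
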